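(* Let $N\ge1$, let $x_p\neq x_q$ be two points of the unit-modulus $M$-PSK constellation, and consider the differential decode-and-forward system with $N$ error-free relays described in the context, in which the source-destination link and all relay-destination links have the same average SNR $\bar\gamma>0$. Let $$P_e^{x_p,x_q}(\bar\gamma)=\Pr\Big\{t_0+\sum_{m=1}^{N}t_m<0\Big\}$$ be the average pairwise error probability of the piecewise linear decoder (with error-free relays its clipping thresholds are infinite) of deciding $x_q$ when $x_p$ is transmitted. Then $P_e^{x_p,x_q}\propto \bar\gamma^{-(N+1)}$ as $\bar\gamma\to\infty$; that is, $\bar\gamma^{\,N+1}P_e^{x_p,x_q}(\bar\gamma)$ converges to a positive finite constant, so the decoder achieves diversity $N+1$.
   Context: $\mathcal{CN}(0,\eta)$ is the circular complex Gaussian law with variance $\eta$ (density $\frac{1}{\pi\eta}e^{-|z|^2/\eta}$), and $^*$ is complex conjugation. Index the links by $m=0$ (source-destination) and $m=1,\dots,N$ (relay $m$-destination). Link $m$ has noise variance $N_m>0$ and channel gain $h_m\sim\mathcal{CN}(0,\bar\gamma N_m)$, constant over the two consecutive times $n-1$ and $n$. The received samples are $y_m[n-1]=h_mv_m[n-1]+e_m[n-1]$ and $y_m[n]=h_mv_m[n]+e_m[n]$, with noises $e_m[\cdot]\sim\mathcal{CN}(0,N_m)$. All channel gains and noises are mutually independent. The differentially encoded symbols satisfy $|v_m[n-1]|=1$ (deterministic) and $v_m[n]=v_m[n-1]x_p$ on every link (the source sends $x_p$ and all relays forward it without error). The decision statistics are $$t_m=\frac{1}{N_m}\mathrm{Re}\{y_m^*[n]\,y_m[n-1]\,(x_p-x_q)\},\qquad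 m=0,1,\dots,N.$$ *)

theory Defs
  imports "HOL-Probability.Probability"
begin

definition psk :: "nat \<Rightarrow> complex set" where
  "psk M = {cis (2 * pi * real k / real M) | k. k < M}"

definition circular_gaussian_density :: "real \<Rightarrow> complex \<Rightarrow> real" where
  "circular_gaussian_density \<eta> z = 1 / (pi * \<eta>) * exp (- (cmod z)\<^sup>2 / \<eta>)"

abbreviation (in prob_space) circular_gaussian :: "real \<Rightarrow> ('a \<Rightarrow> complex) \<Rightarrow> bool" where
  "circular_gaussian \<eta> X \<equiv>
     distributed M lborel X (\<lambda>z. ennreal (circular_gaussian_density \<eta> z))"

text \<open>
  Link \<open>0\<close> is the source-destination link and links \<open>1, \<dots>, N\<close> are the relay-destination links.
  The number \<open>\<sigma> m\<close> is the noise variance of link \<open>m\<close>, \<open>h m\<close> its gain over the two times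
  \<open>n - 1\<close> and \<open>n\<close>, and \<open>e m k\<close> its noise at time \<open>k\<close>. Times are integers, so that \<open>n - 1\<close>
  is not truncated.
\<close>

locale relay_links = prob_space P
  for P :: "'a measure" +
  fixes N :: nat
    and \<gamma> :: real
    and \<sigma> :: "nat \<Rightarrow> real"
    and n :: int
    and h :: "nat \<Rightarrow> 'a \<Rightarrow> complex"
    and e :: "nat \<Rightarrow> int \<Rightarrow> 'a \<Rightarrow> complex"
  assumes gain: "m \<le> N \<Longrightarrow> circular_gaussian (\<gamma> * \<sigma> m) (h m)"
    and noise: "m \<le> N \<Longrightarrow> k \<in> {n - 1, n} \<Longrightarrow> circular_gaussian (\<sigma> m) (e m k)"
    and indep: "indep_vars (\<lambda>_. borel) (case_sum h (\<lambda>(m, k). e m k))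
                  ({..N} <+> {..N} \<times> {n - 1, n})"

definition received ::
  "(nat \<Rightarrow> 'a \<Rightarrow> complex) \<Rightarrow> (nat \<Rightarrow> int \<Rightarrow> 'a \<Rightarrow> complex) \<Rightarrow> (nat \<Rightarrow> int \<Rightarrow> complex) \<Rightarrow>
   nat \<Rightarrow> int \<Rightarrow> 'a \<Rightarrow> complex" where
  "received h e v m k \<omega> = h m \<omega> * v m k + e m k \<omega>"

definition decision_statistic ::
  "(nat \<Rightarrow> real) \<Rightarrow> (nat \<Rightarrow> int \<Rightarrow> 'a \<Rightarrow> complex) \<Rightarrow> int \<Rightarrow> complex \<Rightarrow> complex \<Rightarrow>
   nat \<Rightarrow> 'a \<Rightarrow> real" where
  "decision_statistic \<sigma> y n x\<^sub>p x\<^sub>q m \<omega> =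
     1 / \<sigma> m * Re (cnj (y m n \<omega>) * y m (n - 1) \<omega> * (x\<^sub>p - x\<^sub>q))"

definition pairwise_error_prob :: "'a measure \<Rightarrow> nat \<Rightarrow> (nat \<Rightarrow> 'a \<Rightarrow> real) \<Rightarrow> real" where
  "pairwise_error_prob P N t =
     measure P {\<omega> \<in> space P. t 0 \<omega> + (\<Sum>m = 1..N. t m \<omega>) < 0}"

definition achieves_diversity :: "(real \<Rightarrow> real) \<Rightarrow> real \<Rightarrow> bool" where
  "achieves_diversity p d \<longleftrightarrow> ((\<lambda>\<gamma>. - ln (p \<gamma>) / ln \<gamma>) \<longlongrightarrow> d) at_top"

end

(*
  Rescale the gain densities: gamma times the CN(0, gamma N_m) density
  increases to the constant 1 / (pi N_m), whereas the error event, written in terms of the gains and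
  noises, does not depend on gamma. Hence gamma^(N+1) P_e converges to the integral of the noise
  densities times prod 1 / (pi N_m) over the error event, with Lebesgue measure in the gains. It is
  positive because the error event contains an open set, and finite by a Chernoff bound: a small
  negative multiple of the total statistic plus the Gaussian noise exponents is bounded above by a
  negative definite quadratic form.
*)
theory Submission
  imports Defs
begin

section \<open>Joint densities of independent random variables\<close>

text \<open>A measure on a finite product is determined by its values on boxes, and there the
  integral of the product density factorises by Tonelli.\<close>

lemma density_PiM:
  assumes "finite I" and "\<And>i. sigma_finite_measure (M i)"
    and f[measurable]: "\<And>i. i \<in> I \<Longrightarrow> f i \<in> borel_measurable (M i)"
    and "\<And>i. i \<in> I \<Longrightarrow> sigma_finite_measure (density (M i) (f i))"
  shows "density (PiM I M) (\<lambda>x. \<Prod>i\<in>I. f i (x i)) = PiM I (\<lambda>i. density (M i) (f i))"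
proof -
  interpret M: product_sigma_finite M
    using assms by (simp add: product_sigma_finite_def)
  \<comment> \<open>The locale \<open>product_sigma_finite\<close> asks for sigma-finiteness at
    every index, whereas the densities are known to be sigma-finite only on \<open>I\<close>;
    outside \<open>I\<close> the original measures are kept.\<close>
  let ?D = "\<lambda>i. if i \<in> I then density (M i) (f i) else M i"
  interpret D: product_sigma_finite ?D
    using assms by (simp add: product_sigma_finite_def)
  note [simp] = \<open>finite I\<close>
  have "density (PiM I M) (\<lambda>x. \<Prod>i\<in>I. f i (x i)) = PiM I ?D"
  proof (rule D.PiM_eqI)
    show "sets (density (PiM I M) (\<lambda>x. \<Prod>i\<in>I. f i (x i))) = sets (PiM I ?D)"
      by (simp cong: sets_PiM_cong)
    fix A assume A: "\<And>i. i \<in> I \<Longrightarrow> A i \<in> sets (?D i)"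
    then have A'[measurable]: "\<And>i. i \<in> I \<Longrightarrow> A i \<in> sets (M i)" by simp
    have "emeasure (density (PiM I M) (\<lambda>x. \<Prod>i\<in>I. f i (x i))) (PiE I A) =
        (\<integral>\<^sup>+x. (\<Prod>i\<in>I. f i (x i)) * indicator (PiE I A) x \<partial>PiM I M)"
      by (intro emeasure_density sets_PiM_I_finite) auto
    also have "\<dots> = (\<integral>\<^sup>+x. (\<Prod>i\<in>I. f i (x i) * indicator (A i) (x i)) \<partial>PiM I M)"
    proof (intro nn_integral_cong)
      fix x assume "x \<in> space (PiM I M)"
      \<comment> \<open>Points of the product space are already extensional, so membership in the
        box is a condition on the coordinates in \<open>I\<close> alone.\<close>
      then have "indicator (PiE I A) x = (\<Prod>i\<in>I. indicator (A i) (x i) :: ennreal)"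
        by (cases "x \<in> PiE I A") (auto simp: space_PiM PiE_iff prod_zero_iff split: split_indicator)
      then show "(\<Prod>i\<in>I. f i (x i)) * indicator (PiE I A) x =
          (\<Prod>i\<in>I. f i (x i) * indicator (A i) (x i))"
        by (simp add: prod.distrib)
    qed
    also have "\<dots> = (\<Prod>i\<in>I. \<integral>\<^sup>+z. f i z * indicator (A i) z \<partial>M i)"
      by (rule M.product_nn_integral_prod) auto
    also have "\<dots> = (\<Prod>i\<in>I. emeasure (?D i) (A i))"
      by (intro prod.cong) (auto simp: emeasure_density)
    finally show "emeasure (density (PiM I M) (\<lambda>x. \<Prod>i\<in>I. f i (x i))) (PiE I A) =
        (\<Prod>i\<in>I. emeasure (?D i) (A i))" .
  qed simp
  also have "\<dots> = PiM I (\<lambda>i. density (M i) (f i))"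
    by (intro PiM_cong) auto
  finally show ?thesis .
qed

text \<open>Independence makes the joint law the product of the marginal laws, to which
  \<open>density_PiM\<close> applies. This supplies the joint density of all gains and
  noises.\<close>

lemma (in prob_space) distributed_PiM_indep:
  assumes "finite I" "I \<noteq> {}" and "\<And>i. sigma_finite_measure (S i)"
    and indep: "indep_vars S X I" and X: "\<And>i. i \<in> I \<Longrightarrow> distributed M (S i) (X i) (f i)"
  shows "distributed M (PiM I S) (\<lambda>\<omega>. \<lambda>i\<in>I. X i \<omega>) (\<lambda>x. \<Prod>i\<in>I. f i (x i))"
proof -
  have rv[measurable]: "\<And>i. i \<in> I \<Longrightarrow> random_variable (S i) (X i)"
    and f[measurable]: "\<And>i. i \<in> I \<Longrightarrow> f i \<in> borel_measurable (S i)"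
    and D: "\<And>i. i \<in> I \<Longrightarrow> distr M (S i) (X i) = density (S i) (f i)"
    using X by (auto simp: distributed_def)
  have "distr M (PiM I S) (\<lambda>\<omega>. \<lambda>i\<in>I. X i \<omega>) = PiM I (\<lambda>i. distr M (S i) (X i))"
    using indep_vars_iff_distr_eq_PiM'[of I X S, OF \<open>I \<noteq> {}\<close> rv] indep by blast
  also have "\<dots> = PiM I (\<lambda>i. density (S i) (f i))"
    by (intro PiM_cong D) auto
  also have "\<dots> = density (PiM I S) (\<lambda>x. \<Prod>i\<in>I. f i (x i))"
  proof (rule density_PiM[symmetric])
    fix i assume "i \<in> I"
    then have "prob_space (density (S i) (f i))"
      using D[of i] prob_space_distr[OF rv] by metis
    then show "sigma_finite_measure (density (S i) (f i))"
      by (rule prob_space_imp_sigma_finite)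
  qed (use assms in auto)
  finally show ?thesis
    using \<open>finite I\<close> by (auto simp: distributed_def)
qed

text \<open>The mere existence of a variable with this density forces total mass one, so no Gaussian
  integral has to be evaluated.\<close>

lemma (in prob_space) integrable_circular_gaussian_density:
  assumes "circular_gaussian \<eta> X" "\<eta> > 0"
  shows "integrable lborel (circular_gaussian_density \<eta>)"
proof -
  have "(\<integral>\<^sup>+z. ennreal (circular_gaussian_density \<eta> z) * 1 \<partial>lborel) = (\<integral>\<^sup>+\<omega>. 1 \<partial>M)"
    by (rule distributed_nn_integral[OF assms(1)]) simp
  then have "(\<integral>\<^sup>+z. ennreal (circular_gaussian_density \<eta> z) \<partial>lborel) = 1"
    by (simp add: emeasure_space_1)
  moreover have "circular_gaussian_density \<eta> \<in> borel_measurable lborel"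
    unfolding circular_gaussian_density_def by measurable
  moreover have "circular_gaussian_density \<eta> z \<ge> 0" for z
    using \<open>\<eta> > 0\<close> by (simp add: circular_gaussian_density_def)
  ultimately show ?thesis
    by (intro integrableI_nonneg) auto
qed

section \<open>Quadratic lower bound for a single link\<close>

text \<open>Here \<open>H\<close> is the noiseless sample at time \<open>n - 1\<close>,
  \<open>w\<close> and \<open>z\<close> are the noises at \<open>n - 1\<close> and \<open>n\<close>,
  and \<open>a\<close>, \<open>b\<close> are the two constellation points. The pure signal term
  contributes half of \<open>(cmod (a - b))\<^sup>2\<close> times the gain power; the cross terms
  consume at most half of that, at the price of noise power.\<close>

lemma decision_product_lower_bound:
  fixes H z w a b :: complex
  assumes "cmod a = 1" "cmod b = 1"
  shows "Re (cnj (H * a + z) * (H + w) * (a - b)) \<ge>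
    (cmod (a - b))\<^sup>2 / 4 * (cmod H)\<^sup>2 - 3 * ((cmod w)\<^sup>2 + (cmod z)\<^sup>2)"
proof -
  define D where "D = cmod (a - b)"
  have D: "0 \<le> D" "D \<le> 2"
    using norm_triangle_ineq4[of a b] assms by (auto simp: D_def)
  have sq: "(Re a)\<^sup>2 + (Im a)\<^sup>2 = 1" "(Re b)\<^sup>2 + (Im b)\<^sup>2 = 1"
    using assms by (simp_all add: cmod_def)
  \<comment> \<open>For unit moduli both sides equal one minus the real part of
    \<open>cnj a * b\<close>.\<close>
  have r: "Re (cnj a * (a - b)) = D\<^sup>2 / 2"
    unfolding D_def cmod_power2 using sq by (simp add: power2_eq_square algebra_simps)
  have "cnj (H * a + z) * (H + w) * (a - b) = cnj H * H * (cnj a * (a - b)) +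
      (cnj H * cnj a * w * (a - b) + cnj z * H * (a - b) + cnj z * w * (a - b))"
    by (simp add: algebra_simps)
  moreover have "Re (cnj H * H * (cnj a * (a - b))) = (cmod H)\<^sup>2 * (D\<^sup>2 / 2)"
    unfolding r[symmetric] mult.commute[of "cnj H"] complex_norm_square[symmetric]
    by (simp add: Re_complex_of_real)
  moreover have "\<bar>Re (cnj H * cnj a * w * (a - b) + cnj z * H * (a - b) + cnj z * w * (a - b))\<bar>
      \<le> cmod H * cmod w * D + cmod z * cmod H * D + cmod z * cmod w * D"
    unfolding D_def
    by (rule order_trans[OF abs_Re_le_cmod] order_trans[OF norm_triangle_ineq] add_mono)+
      (simp_all add: norm_mult assms)
  \<comment> \<open>The square is weighted so that each of the two gain-noise terms costs a quarter
    of the signal term. The noise coefficient 3 is 2 from here plus 1 from the noise-noise term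
    below.\<close>
  moreover have "cmod H * cmod w * D \<le> D\<^sup>2 / 8 * (cmod H)\<^sup>2 + 2 * (cmod w)\<^sup>2"
    using zero_le_power2[of "D * cmod H - 4 * cmod w"]
    by (simp add: power2_eq_square algebra_simps)
  moreover have "cmod z * cmod H * D \<le> D\<^sup>2 / 8 * (cmod H)\<^sup>2 + 2 * (cmod z)\<^sup>2"
    using zero_le_power2[of "D * cmod H - 4 * cmod z"]
    by (simp add: power2_eq_square algebra_simps)
  moreover have "cmod z * cmod w * D \<le> cmod z * cmod w * 2"
    using D by (intro mult_left_mono) auto
  moreover have "cmod z * cmod w * 2 \<le> (cmod w)\<^sup>2 + (cmod z)\<^sup>2"
    using zero_le_power2[of "cmod z - cmod w"]
    by (simp add: power2_eq_square algebra_simps)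
  ultimately show ?thesis
    unfolding D_def[symmetric] by (simp add: algebra_simps)
qed

lemma decision_statistic_measurable:
  assumes [measurable]: "h m \<in> borel_measurable M" "e m n \<in> borel_measurable M"
    "e m (n - 1) \<in> borel_measurable M"
  shows "decision_statistic \<sigma> (received h e v) n a b m \<in> borel_measurable M"
proof -
  have [measurable]: "cnj \<in> borel_measurable borel" "Re \<in> borel_measurable borel"
    by (intro borel_measurable_continuous_onI continuous_intros)+
  show ?thesis
    unfolding decision_statistic_def[abs_def] received_def[abs_def] by measurable
qed

section \<open>Inputs, statistics and rescaled weights\<close>

text \<open>Collects the data that do not vary with \<gamma>. No probability space is fixed, so the
  same integrals over \<open>input_space\<close> serve every \<open>P \<gamma>\<close>.\<close>

locale error_free_links =
  fixes N :: nat and x\<^sub>p x\<^sub>q :: complex and \<sigma> :: "nat \<Rightarrow> real" and n :: int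
    and v :: "nat \<Rightarrow> int \<Rightarrow> complex"
  assumes unit: "cmod x\<^sub>p = 1" "cmod x\<^sub>q = 1" and distinct: "x\<^sub>p \<noteq> x\<^sub>q"
    and variance_pos: "m \<le> N \<Longrightarrow> \<sigma> m > 0"
    and unit_symbol: "m \<le> N \<Longrightarrow> cmod (v m (n - 1)) = 1"
    and encoding: "m \<le> N \<Longrightarrow> v m n = v m (n - 1) * x\<^sub>p"
begin

abbreviation inputs :: "(nat + nat \<times> int) set" where
  "inputs \<equiv> {..N} <+> {..N} \<times> {n - 1, n}"

abbreviation input_space :: "(nat + nat \<times> int \<Rightarrow> complex) measure" where
  "input_space \<equiv> PiM inputs (\<lambda>_. lborel)"

text \<open>The gains and noises are coordinate projections here: the input vector itself plays the
  role of the sample point.\<close>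

definition link_statistic :: "nat \<Rightarrow> (nat + nat \<times> int \<Rightarrow> complex) \<Rightarrow> real" where
  "link_statistic =
    decision_statistic \<sigma> (received (\<lambda>m x. x (Inl m)) (\<lambda>m k x. x (Inr (m, k))) v) n x\<^sub>p x\<^sub>q"

abbreviation total_statistic :: "(nat + nat \<times> int \<Rightarrow> complex) \<Rightarrow> real" where
  "total_statistic x \<equiv> \<Sum>m\<le>N. link_statistic m x"

text \<open>With \<open>s = 1 / \<gamma>\<close>, the gain factors are \<open>\<gamma>\<close> times their densities;
  they remain meaningful at \<open>s = 0\<close>.\<close>

definition weight :: "real \<Rightarrow> nat + nat \<times> int \<Rightarrow> complex \<Rightarrow> real" where
  "weight s = case_sum (\<lambda>m z. 1 / (pi * \<sigma> m) * exp (- s * (cmod z)\<^sup>2 / \<sigma> m))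
     (\<lambda>(m, k). circular_gaussian_density (\<sigma> m))"

definition error_integrand :: "real \<Rightarrow> (nat + nat \<times> int \<Rightarrow> complex) \<Rightarrow> real" where
  "error_integrand s x = (\<Prod>i\<in>inputs. weight s i (x i)) * indicator {x. total_statistic x < 0} x"

text \<open>Regrouping the coordinates by link allows estimates to be made one link at a
  time.\<close>

lemma prod_inputs:
  "(\<Prod>i\<in>inputs. f i :: real) = (\<Prod>m\<le>N. f (Inl m) * (f (Inr (m, n - 1)) * f (Inr (m, n))))"
proof -
  have "(\<Prod>p\<in>{..N} \<times> {n - 1, n}. f (Inr p)) = (\<Prod>m\<le>N. \<Prod>k\<in>{n - 1, n}. f (Inr (m, k)))"
    by (simp only: prod.cartesian_product) (simp add: case_prod_unfold)
  then show ?thesis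
    by (simp add: prod.Plus prod.distrib)
qed

lemma weight_measurable[measurable]: "weight s i \<in> borel_measurable lborel"
  unfolding weight_def circular_gaussian_density_def by (cases i) (auto split: prod.split)

lemma weight_pos: "i \<in> inputs \<Longrightarrow> weight s i z > 0"
  using variance_pos by (auto simp: weight_def circular_gaussian_density_def)

lemma link_statistic_measurable:
  assumes "m \<le> N" shows "link_statistic m \<in> borel_measurable input_space"
proof -
  have "Inl m \<in> inputs" "Inr (m, n) \<in> inputs" "Inr (m, n - 1) \<in> inputs"
    using assms by auto
  then have "(\<lambda>x. x (Inl m)) \<in> borel_measurable input_space"
    "(\<lambda>x. x (Inr (m, n))) \<in> borel_measurable input_space"
    "(\<lambda>x. x (Inr (m, n - 1))) \<in> borel_measurable input_space"
    using measurable_component_singleton[of _ inputs "\<lambda>_. lborel :: complex measure"] by auto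
  then show ?thesis
    unfolding link_statistic_def by (intro decision_statistic_measurable) auto
qed

lemma total_statistic_measurable[measurable]: "total_statistic \<in> borel_measurable input_space"
  by (intro borel_measurable_sum link_statistic_measurable) simp

lemma error_integrand_measurable[measurable]:
  "error_integrand s \<in> borel_measurable input_space"
proof -
  have [measurable]: "(indicator {x. total_statistic x < 0} :: _ \<Rightarrow> real) \<in> borel_measurable input_space"
    unfolding indicator_def of_bool_def mem_Collect_eq by measurable
  have "(\<lambda>x. \<Prod>i\<in>inputs. weight s i (x i)) \<in> borel_measurable input_space"
    by (intro borel_measurable_prod measurable_compose[OF measurable_component_singleton]) auto
  then show ?thesis
    unfolding error_integrand_def[abs_def] by measurable
qed

lemma error_integrand_nonneg: "error_integrand s x \<ge> 0"
  unfolding error_integrand_def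
  by (intro mult_nonneg_nonneg prod_nonneg less_imp_le[OF weight_pos]) auto

section \<open>An integrable majorant uniform in \<gamma>\<close>

text \<open>By differential encoding both samples carry the same vector
  \<open>x (Inl m) * v m (n - 1)\<close>, whose modulus is that of the gain, so the bound for
  \<open>decision_product_lower_bound\<close> applies.\<close>

lemma link_statistic_lower_bound:
  assumes "m \<le> N"
  shows "link_statistic m x \<ge> ((cmod (x\<^sub>p - x\<^sub>q))\<^sup>2 / 4 * (cmod (x (Inl m)))\<^sup>2
    - 3 * ((cmod (x (Inr (m, n - 1))))\<^sup>2 + (cmod (x (Inr (m, n))))\<^sup>2)) / \<sigma> m"
proof -
  let ?H = "x (Inl m) * v m (n - 1)"
  have "link_statistic m x = Re (cnj (?H * x\<^sub>p + x (Inr (m, n))) * (?H + x (Inr (m, n - 1))) * (x\<^sub>p - x\<^sub>q)) / \<sigma> m"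
    by (simp only: link_statistic_def decision_statistic_def received_def encoding[OF assms] mult.assoc) simp
  moreover have "cmod ?H = cmod (x (Inl m))"
    by (simp add: norm_mult unit_symbol[OF assms])
  ultimately show ?thesis
    using divide_right_mono[OF decision_product_lower_bound[OF unit], of "\<sigma> m" ?H "x (Inr (m, n - 1))" "x (Inr (m, n))"]
      variance_pos[OF assms] by simp
qed

text \<open>The prefactors cancel the enlarged variances, leaving the normalisation
  \<open>1 / (pi * \<sigma> m)\<close> of \<open>weight\<close>. Writing the factors as Gaussian
  densities reduces integrability to the known one.\<close>

definition majorant :: "nat + nat \<times> int \<Rightarrow> complex \<Rightarrow> real" where
  "majorant = case_sum
     (\<lambda>m z. 24 / (cmod (x\<^sub>p - x\<^sub>q))\<^sup>2 * circular_gaussian_density (24 / (cmod (x\<^sub>p - x\<^sub>q))\<^sup>2 * \<sigma> m) z)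
     (\<lambda>(m, k) z. 2 * circular_gaussian_density (2 * \<sigma> m) z)"

text \<open>Chernoff bound: the indicator of a negative total statistic is at most
  \<open>exp (- total_statistic x / 6)\<close>, which factorises over the links.\<close>

lemma error_integrand_le_majorant:
  assumes "s \<ge> 0"
  shows "error_integrand s x \<le> (\<Prod>i\<in>inputs. majorant i (x i))"
proof -
  define D where "D = cmod (x\<^sub>p - x\<^sub>q)"
  have "D > 0" using distinct by (simp add: D_def)
  have "error_integrand s x \<le> (\<Prod>i\<in>inputs. weight s i (x i)) * exp (- total_statistic x / 6)"
    unfolding error_integrand_def
    by (intro mult_left_mono prod_nonneg less_imp_le[OF weight_pos]) (auto split: split_indicator)
  also have "exp (- total_statistic x / 6) = (\<Prod>m\<le>N. exp (- link_statistic m x / 6))"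
    by (simp add: exp_sum[symmetric] sum_negf sum_divide_distrib)
  also have "(\<Prod>i\<in>inputs. weight s i (x i)) * (\<Prod>m\<le>N. exp (- link_statistic m x / 6)) =
      (\<Prod>m\<le>N. weight s (Inl m) (x (Inl m)) * (weight s (Inr (m, n - 1)) (x (Inr (m, n - 1))) *
        weight s (Inr (m, n)) (x (Inr (m, n)))) * exp (- link_statistic m x / 6))"
    by (simp add: prod_inputs prod.distrib)
  also have "\<dots> \<le> (\<Prod>m\<le>N. majorant (Inl m) (x (Inl m)) *
      (majorant (Inr (m, n - 1)) (x (Inr (m, n - 1))) * majorant (Inr (m, n)) (x (Inr (m, n)))))"
  proof (intro prod_mono conjI)
    fix m assume "m \<in> {..N}"
    then have m: "m \<le> N" by simp
    define h w z where "h = (cmod (x (Inl m)))\<^sup>2" "w = (cmod (x (Inr (m, n - 1))))\<^sup>2"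
      "z = (cmod (x (Inr (m, n))))\<^sup>2"
    have pos: "\<sigma> m > 0" by (rule variance_pos[OF m])
    show "0 \<le> weight s (Inl m) (x (Inl m)) * (weight s (Inr (m, n - 1)) (x (Inr (m, n - 1))) *
        weight s (Inr (m, n)) (x (Inr (m, n)))) * exp (- link_statistic m x / 6)"
      using m by (intro mult_nonneg_nonneg less_imp_le[OF weight_pos]) auto
    let ?c = "1 / (pi * \<sigma> m)"
    \<comment> \<open>Discarding the nonpositive gain exponent makes the bound independent of
      \<open>s\<close>. Since 3/6 is one half, the multiplier 1/6 leaves half of each noise
      exponent, and the statistic itself supplies the decay \<open>D\<^sup>2 / 24\<close> in the
      gain.\<close>
    have "- s * h / \<sigma> m + (- w / \<sigma> m + - z / \<sigma> m) + - link_statistic m x / 6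
        \<le> (- w / \<sigma> m + - z / \<sigma> m) - ((D\<^sup>2 / 4 * h - 3 * (w + z)) / \<sigma> m) / 6"
    proof -
      have "- s * h / \<sigma> m \<le> 0" using assms pos by (simp add: h_w_z_def)
      moreover have "(D\<^sup>2 / 4 * h - 3 * (w + z)) / \<sigma> m \<le> link_statistic m x"
        using link_statistic_lower_bound[OF m] by (simp only: h_w_z_def D_def)
      moreover have "t + u + - L / 6 \<le> u - q / 6" if "t \<le> 0" "q \<le> L" for t u q L :: real
        using that by simp
      ultimately show ?thesis by blast
    qed
    also have "\<dots> = - (D\<^sup>2 / 24) * h / \<sigma> m + (- w / (2 * \<sigma> m) + - z / (2 * \<sigma> m))"
      using pos by (simp add: field_simps)
    finally have le: "- s * h / \<sigma> m + (- w / \<sigma> m + - z / \<sigma> m) + - link_statistic m x / 6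
      \<le> - (D\<^sup>2 / 24) * h / \<sigma> m + (- w / (2 * \<sigma> m) + - z / (2 * \<sigma> m))" .
    have "weight s (Inl m) (x (Inl m)) * (weight s (Inr (m, n - 1)) (x (Inr (m, n - 1))) *
        weight s (Inr (m, n)) (x (Inr (m, n)))) * exp (- link_statistic m x / 6) =
      ?c * ?c * ?c * exp (- s * h / \<sigma> m + (- w / \<sigma> m + - z / \<sigma> m) + - link_statistic m x / 6)"
      unfolding exp_add by (simp add: weight_def circular_gaussian_density_def h_w_z_def)
    also have "\<dots> \<le> ?c * ?c * ?c *
        exp (- (D\<^sup>2 / 24) * h / \<sigma> m + (- w / (2 * \<sigma> m) + - z / (2 * \<sigma> m)))"
      using pos le by (intro mult_left_mono) auto
    also have "\<dots> = majorant (Inl m) (x (Inl m)) *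
        (majorant (Inr (m, n - 1)) (x (Inr (m, n - 1))) * majorant (Inr (m, n)) (x (Inr (m, n))))"
      unfolding exp_add using \<open>D > 0\<close>
      by (simp add: majorant_def circular_gaussian_density_def h_w_z_def D_def[symmetric] mult_ac)
    finally show "weight s (Inl m) (x (Inl m)) * (weight s (Inr (m, n - 1)) (x (Inr (m, n - 1))) *
        weight s (Inr (m, n)) (x (Inr (m, n)))) * exp (- link_statistic m x / 6) \<le> \<dots>" .
  qed
  also have "\<dots> = (\<Prod>i\<in>inputs. majorant i (x i))"
    by (simp add: prod_inputs)
  finally show ?thesis .
qed

lemma majorant_integrable:
  assumes "\<And>\<eta>. \<eta> > 0 \<Longrightarrow> integrable lborel (circular_gaussian_density \<eta>)"
  shows "integrable input_space (\<lambda>x. \<Prod>i\<in>inputs. majorant i (x i))"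
proof -
  interpret product_sigma_finite "\<lambda>_ :: nat + nat \<times> int. lborel :: complex measure" ..
  show ?thesis
  proof (rule product_integrable_prod)
    fix i assume i: "i \<in> inputs"
    show "integrable lborel (majorant i)"
    proof (cases i)
      case (Inl m)
      then have "24 / (cmod (x\<^sub>p - x\<^sub>q))\<^sup>2 * \<sigma> m > 0"
        using i variance_pos distinct by (intro mult_pos_pos) auto
      then show ?thesis
        unfolding majorant_def Inl sum.case by (intro integrable_mult_right assms)
    next
      case (Inr p)
      then show ?thesis
        using i variance_pos by (auto simp: majorant_def intro!: assms)
    qed
  qed simp
qed

section \<open>Pointwise limit and integral representation\<close>

text \<open>Only the gain weights depend on \<gamma>; the indicator of the error event is the same
  throughout.\<close>

lemma tendsto_error_integrand:
  "((\<lambda>\<gamma>. error_integrand (1 / \<gamma>) x) \<longlongrightarrow> error_integrand 0 x) at_top"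
proof -
  have "((\<lambda>\<gamma>. weight (1 / \<gamma>) i (x i)) \<longlongrightarrow> weight 0 i (x i)) at_top" if "i \<in> inputs" for i
  proof -
    have "((\<lambda>\<gamma>::real. 1 / \<gamma>) \<longlongrightarrow> 0) at_top"
      by (rule tendsto_divide_0[OF tendsto_const filterlim_at_top_imp_at_infinity[OF filterlim_ident]])
    then show ?thesis
    proof (cases i)
      case (Inl m)
      then have "\<sigma> m > 0" using that variance_pos by auto
      with \<open>((\<lambda>\<gamma>::real. 1 / \<gamma>) \<longlongrightarrow> 0) at_top\<close> show ?thesis
        unfolding weight_def Inl sum.case by (intro tendsto_intros) auto
    qed (simp add: weight_def case_prod_unfold)
  qed
  then show ?thesis
    unfolding error_integrand_def by (intro tendsto_intros)
qed

text \<open>The probability is the joint density integrated over the error event, and each of the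
  \<open>N + 1\<close> gain densities absorbs one factor \<gamma>.\<close>

lemma error_prob_eq_integral:
  assumes "relay_links P N \<gamma> \<sigma> n h e" "\<gamma> > 0"
  shows "\<gamma> ^ (N + 1) * pairwise_error_prob P N (decision_statistic \<sigma> (received h e v) n x\<^sub>p x\<^sub>q) =
    integral\<^sup>L input_space (error_integrand (1 / \<gamma>))"
proof -
  interpret relay_links P N \<gamma> \<sigma> n h e by fact
  let ?X = "case_sum h (\<lambda>(m, k). e m k)"
  let ?Y = "\<lambda>\<omega>. \<lambda>i\<in>inputs. ?X i \<omega>"
  let ?E = "{x\<in>space input_space. total_statistic x < 0}"
  define f where "f = case_sum (\<lambda>m. circular_gaussian_density (\<gamma> * \<sigma> m))
    (\<lambda>(m, k :: int). circular_gaussian_density (\<sigma> m))"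
  have f_nonneg: "f i z \<ge> 0" if "i \<in> inputs" for i z
    using that variance_pos \<open>\<gamma> > 0\<close>
    by (auto simp: f_def circular_gaussian_density_def intro: less_imp_le)
  \<comment> \<open>Independence involves only the sigma-algebras, which \<open>borel\<close> and
    \<open>lborel\<close> share.\<close>
  have "indep_vars (\<lambda>_. lborel) ?X inputs"
    using indep unfolding indep_vars_def by simp
  moreover have "distributed P lborel (?X i) (\<lambda>z. ennreal (f i z))" if "i \<in> inputs" for i
    using that gain noise by (auto simp: f_def)
  ultimately have Y: "distributed P input_space ?Y (\<lambda>x. \<Prod>i\<in>inputs. ennreal (f i (x i)))"
    by (intro distributed_PiM_indep) (auto simp: sigma_finite_lborel)
  \<comment> \<open>Restricting the vector to \<open>inputs\<close> is harmless, since link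
    \<open>m\<close> reads only coordinates in that set.\<close>
  have statistic: "decision_statistic \<sigma> (received h e v) n x\<^sub>p x\<^sub>q m \<omega> = link_statistic m (?Y \<omega>)"
    if "m \<le> N" for m \<omega>
    using that by (auto simp: link_statistic_def decision_statistic_def received_def)
  have E[measurable]: "?E \<in> sets input_space"
    by measurable
  have split: "{..N} = insert 0 {1..N}" by auto
  have "{\<omega> \<in> space P. decision_statistic \<sigma> (received h e v) n x\<^sub>p x\<^sub>q 0 \<omega> +
        (\<Sum>m = 1..N. decision_statistic \<sigma> (received h e v) n x\<^sub>p x\<^sub>q m \<omega>) < 0} =
      ?Y -` ?E \<inter> space P"
    using measurable_space[OF distributed_measurable[OF Y]]
    by (auto simp: split statistic)
  then have "ennreal (pairwise_error_prob P N (decision_statistic \<sigma> (received h e v) n x\<^sub>p x\<^sub>q)) =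
      emeasure P (?Y -` ?E \<inter> space P)"
    by (simp add: pairwise_error_prob_def emeasure_eq_measure)
  also have "\<dots> = (\<integral>\<^sup>+x. (\<Prod>i\<in>inputs. ennreal (f i (x i))) * indicator ?E x \<partial>input_space)"
    by (rule distributed_emeasure[OF Y E])
  finally have "ennreal (\<gamma> ^ (N + 1)) *
      ennreal (pairwise_error_prob P N (decision_statistic \<sigma> (received h e v) n x\<^sub>p x\<^sub>q)) =
      (\<integral>\<^sup>+x. ennreal (\<gamma> ^ (N + 1)) * ((\<Prod>i\<in>inputs. ennreal (f i (x i))) * indicator ?E x) \<partial>input_space)"
    using distributed_borel_measurable[OF Y] by (simp add: nn_integral_cmult)
  also have "\<dots> = (\<integral>\<^sup>+x. ennreal (error_integrand (1 / \<gamma>) x) \<partial>input_space)"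
  proof (intro nn_integral_cong)
    fix x assume x: "x \<in> space input_space"
    have gain: "\<gamma> * f (Inl m) z = weight (1 / \<gamma>) (Inl m) z" for m z
      using \<open>\<gamma> > 0\<close> by (simp add: f_def weight_def circular_gaussian_density_def)
    have noise: "f (Inr p) = weight (1 / \<gamma>) (Inr p)" for p
      by (simp add: f_def weight_def)
    have "\<gamma> ^ (N + 1) * (\<Prod>i\<in>inputs. f i (x i)) = (\<Prod>i\<in>inputs. weight (1 / \<gamma>) i (x i))"
      unfolding prod_inputs gain[symmetric] noise prod.distrib by (simp add: mult_ac)
    moreover have "(\<Prod>i\<in>inputs. ennreal (f i (x i))) = ennreal (\<Prod>i\<in>inputs. f i (x i))"
      by (intro prod_ennreal f_nonneg)
    moreover have "(\<Prod>i\<in>inputs. f i (x i)) \<ge> 0"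
      by (intro prod_nonneg f_nonneg)
    ultimately show "ennreal (\<gamma> ^ (N + 1)) * ((\<Prod>i\<in>inputs. ennreal (f i (x i))) * indicator ?E x) =
        ennreal (error_integrand (1 / \<gamma>) x)"
      using x \<open>\<gamma> > 0\<close>
      by (auto simp: error_integrand_def ennreal_mult[symmetric] split: split_indicator)
  qed
  finally have "(\<integral>\<^sup>+x. ennreal (error_integrand (1 / \<gamma>) x) \<partial>input_space) = ennreal (\<gamma> ^ (N + 1) *
      pairwise_error_prob P N (decision_statistic \<sigma> (received h e v) n x\<^sub>p x\<^sub>q))"
    using \<open>\<gamma> > 0\<close> by (simp add: ennreal_mult pairwise_error_prob_def)
  moreover have "0 \<le> \<gamma> ^ (N + 1) *
      pairwise_error_prob P N (decision_statistic \<sigma> (received h e v) n x\<^sub>p x\<^sub>q)"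
    using \<open>\<gamma> > 0\<close> by (simp add: pairwise_error_prob_def)
  ultimately show ?thesis
    by (subst integral_eq_nn_integral) (auto simp: error_integrand_nonneg)
qed

section \<open>Positive measure of the error event\<close>

lemma negative_box:
  assumes "m \<le> N"
  shows "\<exists>A B C. open A \<and> A \<noteq> {} \<and> open B \<and> B \<noteq> {} \<and> open C \<and> C \<noteq> {} \<and>
    (\<forall>x. x (Inl m) \<in> A \<longrightarrow> x (Inr (m, n - 1)) \<in> B \<longrightarrow> x (Inr (m, n)) \<in> C \<longrightarrow>
      link_statistic m x < 0)"
proof -
  define q where "q = (\<lambda>(h, w, z). Re (cnj (h * v m n + z) * (h * v m (n - 1) + w) * (x\<^sub>p - x\<^sub>q)))"
  have "continuous_on UNIV q"
    unfolding q_def case_prod_unfold by (intro continuous_intros)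
  then have "open (q -` {..<0})"
    by (intro open_vimage) auto
  \<comment> \<open>With zero gain only the noise product remains; these noise values make it equal
    to minus the squared distance of the two constellation points.\<close>
  moreover have "(0, - cnj (x\<^sub>p - x\<^sub>q), 1) \<in> q -` {..<0}"
  proof -
    have "q (0, - cnj (x\<^sub>p - x\<^sub>q), 1) = - Re (cnj (x\<^sub>p - x\<^sub>q) * (x\<^sub>p - x\<^sub>q))"
      by (simp add: q_def algebra_simps)
    also have "\<dots> = - (cmod (x\<^sub>p - x\<^sub>q))\<^sup>2"
      by (simp only: mult.commute[of "cnj _"] complex_norm_square[symmetric] Re_complex_of_real)
    finally show ?thesis
      using distinct by simp
  qed
  ultimately obtain A B' where A: "open A" "open B'" "(0, - cnj (x\<^sub>p - x\<^sub>q), 1) \<in> A \<times> B'"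
      "A \<times> B' \<subseteq> q -` {..<0}"
    by (rule open_prod_elim)
  then have "(- cnj (x\<^sub>p - x\<^sub>q), 1) \<in> B'" by simp
  with \<open>open B'\<close> obtain B C where B: "open B" "open C" "(- cnj (x\<^sub>p - x\<^sub>q), 1) \<in> B \<times> C" "B \<times> C \<subseteq> B'"
    by (rule open_prod_elim)
  have "link_statistic m x < 0"
    if "x (Inl m) \<in> A" "x (Inr (m, n - 1)) \<in> B" "x (Inr (m, n)) \<in> C" for x
  proof -
    have "link_statistic m x = q (x (Inl m), x (Inr (m, n - 1)), x (Inr (m, n))) / \<sigma> m"
      by (simp add: link_statistic_def decision_statistic_def received_def q_def)
    moreover have "q (x (Inl m), x (Inr (m, n - 1)), x (Inr (m, n))) < 0"
      using that A(4) B(4) by auto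
    ultimately show ?thesis
      using variance_pos[OF assms] by (simp add: divide_neg_pos)
  qed
  then show ?thesis
    using A B by blast
qed

text \<open>If every link statistic is negative, so is the sum; hence the error event contains a
  product of nonempty open sets, which has positive measure.\<close>

lemma negative_set_not_null: "\<not> (AE x in input_space. \<not> total_statistic x < 0)"
proof
  assume ae: "AE x in input_space. \<not> total_statistic x < 0"
  interpret product_sigma_finite "\<lambda>_ :: nat + nat \<times> int. lborel :: complex measure" ..
  obtain A B C where box: "\<And>m. m \<le> N \<Longrightarrow> open (A m) \<and> A m \<noteq> {} \<and> open (B m) \<and> B m \<noteq> {} \<and>
      open (C m) \<and> C m \<noteq> {} \<and> (\<forall>x. x (Inl m) \<in> A m \<longrightarrow> x (Inr (m, n - 1)) \<in> B m \<longrightarrow>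
        x (Inr (m, n)) \<in> C m \<longrightarrow> link_statistic m x < 0)"
    using negative_box by metis
  define S where "S = case_sum A (\<lambda>(m, k). if k = n then C m else B m)"
  have S: "open (S i)" "S i \<noteq> {}" if "i \<in> inputs" for i
    using that box by (auto simp: S_def)
  have neg: "total_statistic x < 0" if "x \<in> PiE inputs S" for x
  proof -
    have "link_statistic m x < 0" if "m \<le> N" for m
    proof -
      have "x (Inl m) \<in> S (Inl m)" "x (Inr (m, n - 1)) \<in> S (Inr (m, n - 1))"
        "x (Inr (m, n)) \<in> S (Inr (m, n))"
        using \<open>x \<in> PiE inputs S\<close> that by (auto elim!: PiE_mem)
      then show ?thesis
        using box[OF that] by (simp add: S_def)
    qed
    then have "(\<Sum>m\<le>N. link_statistic m x) < (\<Sum>m\<le>N. 0)"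
      by (intro sum_strict_mono) auto
    then show ?thesis by simp
  qed
  have "PiE inputs S \<in> sets input_space"
    using S by (intro sets_PiM_I_finite) auto
  moreover have "AE x in input_space. x \<notin> PiE inputs S"
    using ae neg by (auto elim: eventually_mono)
  ultimately have "emeasure input_space (PiE inputs S) = 0"
    by (simp add: AE_iff_null_sets[symmetric] null_setsD1)
  moreover have "emeasure input_space (PiE inputs S) = (\<Prod>i\<in>inputs. emeasure lborel (S i))"
    using S by (intro emeasure_PiM) auto
  moreover have "emeasure lborel (S i) \<noteq> 0" if "i \<in> inputs" for i
  proof
    assume "emeasure lborel (S i) = 0"
    then have "S i \<in> null_sets lebesgue"
      using S[OF that] by (intro null_sets_completionI) auto
    then show False
      using open_not_negligible[OF S[OF that]] by (simp add: negligible_iff_null_sets)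
  qed
  ultimately show False
    by (simp del: finite_Plus_iff add: prod_zero_iff)
qed

section \<open>Passage to the limit and diversity order\<close>

text \<open>Convergence is dominated by the product majorant. The limit is positive because the
  strictly positive weights let \<open>error_integrand 0\<close> vanish only off the error event,
  whose complement is not almost everything.\<close>

lemma tendsto_scaled_error_prob:
  assumes "\<And>\<eta>. \<eta> > 0 \<Longrightarrow> integrable lborel (circular_gaussian_density \<eta>)"
  shows "integral\<^sup>L input_space (error_integrand 0) > 0"
    and "((\<lambda>\<gamma>. integral\<^sup>L input_space (error_integrand (1 / \<gamma>))) \<longlongrightarrow>
      integral\<^sup>L input_space (error_integrand 0)) at_top"
proof -
  note majorant = majorant_integrable[OF assms]
  have integrable: "integrable input_space (error_integrand 0)"
    using error_integrand_nonneg error_integrand_le_majorant[of 0]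
    by (intro Bochner_Integration.integrable_bound[OF majorant]) (auto intro!: AE_I2 order_trans[OF _ abs_ge_self])
  have "integral\<^sup>L input_space (error_integrand 0) \<noteq> 0"
  proof
    assume "integral\<^sup>L input_space (error_integrand 0) = 0"
    then have "AE x in input_space. error_integrand 0 x = 0"
      using integral_nonneg_eq_0_iff_AE[OF integrable] error_integrand_nonneg by simp
    moreover have "\<not> total_statistic x < 0" if "error_integrand 0 x = 0" for x
    proof -
      have "(\<Prod>i\<in>inputs. weight 0 i (x i)) > 0"
        by (intro prod_pos weight_pos)
      then show ?thesis
        using that by (auto simp: error_integrand_def simp del: prod_zero_iff)
    qed
    ultimately have "AE x in input_space. \<not> total_statistic x < 0"
      by (auto elim: eventually_mono)
    then show False
      using negative_set_not_null by contradiction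
  qed
  moreover have "integral\<^sup>L input_space (error_integrand 0) \<ge> 0"
    by (simp add: error_integrand_nonneg)
  ultimately show "integral\<^sup>L input_space (error_integrand 0) > 0"
    by simp
  show "((\<lambda>\<gamma>. integral\<^sup>L input_space (error_integrand (1 / \<gamma>))) \<longlongrightarrow>
      integral\<^sup>L input_space (error_integrand 0)) at_top"
  proof (rule integral_dominated_convergence_at_top[OF _ _ majorant])
    show "\<forall>\<^sub>F \<gamma> in at_top. AE x in input_space.
        norm (error_integrand (1 / \<gamma>) x) \<le> (\<Prod>i\<in>inputs. majorant i (x i))"
      using eventually_ge_at_top[of 0]
      by eventually_elim (simp add: error_integrand_nonneg error_integrand_le_majorant)
    show "AE x in input_space. ((\<lambda>\<gamma>. error_integrand (1 / \<gamma>) x) \<longlongrightarrow> error_integrand 0 x) at_top"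
      by (simp add: tendsto_error_integrand)
  qed measurable
qed

end

text \<open>The logarithm of the scaled quantity stays bounded, so it vanishes after division by
  \<open>ln \<gamma>\<close>; what remains is the exponent \<open>d\<close>.\<close>

lemma achieves_diversityI:
  assumes "((\<lambda>\<gamma>. \<gamma> ^ d * p \<gamma>) \<longlongrightarrow> C) at_top" "C > 0"
  shows "achieves_diversity p (real d)"
proof -
  have "((\<lambda>\<gamma>. ln (\<gamma> ^ d * p \<gamma>)) \<longlongrightarrow> ln C) at_top"
    using assms by (intro tendsto_intros) auto
  then have "((\<lambda>\<gamma>. ln (\<gamma> ^ d * p \<gamma>) / ln \<gamma>) \<longlongrightarrow> 0) at_top"
    by (rule tendsto_divide_0) (rule filterlim_at_top_imp_at_infinity[OF ln_at_top])
  then have "((\<lambda>\<gamma>. real d - ln (\<gamma> ^ d * p \<gamma>) / ln \<gamma>) \<longlongrightarrow> real d - 0) at_top"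
    by (intro tendsto_intros)
  moreover have "\<forall>\<^sub>F \<gamma> in at_top. real d - ln (\<gamma> ^ d * p \<gamma>) / ln \<gamma> = - ln (p \<gamma>) / ln \<gamma>"
    \<comment> \<open>Splitting the logarithm needs \<open>p \<gamma>\<close> positive, which
      follows eventually from the positive limit; \<gamma> above 1 makes the divisor
      positive.\<close>
    using eventually_gt_at_top[of 1] order_tendstoD(1)[OF assms]
  proof eventually_elim
    case (elim \<gamma>)
    then have "p \<gamma> > 0" "ln \<gamma> > 0" by (simp_all add: zero_less_mult_iff)
    with elim show ?case
      by (simp add: ln_mult ln_realpow field_simps)
  qed
  ultimately show ?thesis
    unfolding achieves_diversity_def by (simp add: tendsto_cong)
qed

theorem mainTheorem6:
  fixes N M :: nat
    and x\<^sub>p x\<^sub>q :: complex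
    and \<sigma> :: "nat \<Rightarrow> real"
    and n :: int
    and v :: "nat \<Rightarrow> int \<Rightarrow> complex"
    and P :: "real \<Rightarrow> 'a measure"
    and h :: "real \<Rightarrow> nat \<Rightarrow> 'a \<Rightarrow> complex"
    and e :: "real \<Rightarrow> nat \<Rightarrow> int \<Rightarrow> 'a \<Rightarrow> complex"
    and P\<^sub>e :: "real \<Rightarrow> real"
  assumes "N \<ge> 1"
    and "x\<^sub>p \<in> psk M" and "x\<^sub>q \<in> psk M" and "x\<^sub>p \<noteq> x\<^sub>q"
    and "\<And>m. m \<le> N \<Longrightarrow> \<sigma> m > 0"
    and "\<And>m. m \<le> N \<Longrightarrow> cmod (v m (n - 1)) = 1"
    and "\<And>m. m \<le> N \<Longrightarrow> v m n = v m (n - 1) * x\<^sub>p"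
    and "\<And>\<gamma>. \<gamma> > 0 \<Longrightarrow> relay_links (P \<gamma>) N \<gamma> \<sigma> n (h \<gamma>) (e \<gamma>)"
    and "\<And>\<gamma>. \<gamma> > 0 \<Longrightarrow> P\<^sub>e \<gamma> = pairwise_error_prob (P \<gamma>) N
           (decision_statistic \<sigma> (received (h \<gamma>) (e \<gamma>) v) n x\<^sub>p x\<^sub>q)"
  shows "(\<exists>C>0. ((\<lambda>\<gamma>. \<gamma> ^ (N + 1) * P\<^sub>e \<gamma>) \<longlongrightarrow> C) at_top) \<and>
         achieves_diversity P\<^sub>e (real (N + 1))"
proof -
  interpret error_free_links N x\<^sub>p x\<^sub>q \<sigma> n v
    using assms by unfold_locales (auto simp: psk_def)
  have "integrable lborel (circular_gaussian_density \<eta>)" if "\<eta> > 0" for \<eta>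
  proof -
    \<comment> \<open>This SNR gives the gain of link 0 variance \<open>\<eta>\<close>, so every
      positive variance is realised by some variable of the model.\<close>
    define \<gamma> where "\<gamma> = \<eta> / \<sigma> 0"
    have "\<gamma> > 0" "\<gamma> * \<sigma> 0 = \<eta>"
      using that variance_pos[of 0] by (simp_all add: \<gamma>_def)
    interpret relay_links "P \<gamma>" N \<gamma> \<sigma> n "h \<gamma>" "e \<gamma>"
      using assms(8) \<open>\<gamma> > 0\<close> .
    show ?thesis
      using integrable_circular_gaussian_density[OF gain[of 0]] that \<open>\<gamma> * \<sigma> 0 = \<eta>\<close> by simp
  qed
  note limit = tendsto_scaled_error_prob[OF this]
  have "\<forall>\<^sub>F \<gamma> in at_top. integral\<^sup>L input_space (error_integrand (1 / \<gamma>)) = \<gamma> ^ (N + 1) * P\<^sub>e \<gamma>"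
    using eventually_gt_at_top[of 0]
    by eventually_elim (simp only: error_prob_eq_integral[OF assms(8)] assms(9))
  with limit(2) have "((\<lambda>\<gamma>. \<gamma> ^ (N + 1) * P\<^sub>e \<gamma>) \<longlongrightarrow> integral\<^sup>L input_space (error_integrand 0)) at_top"
    by (rule Lim_transform_eventually)
  with limit(1) show ?thesis
    using achieves_diversityI by blast
qed

end
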